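(* Let $p > 2$ be a prime and let $G$ be a finite non-abelian monolithic $p$-group, i.e. a finite non-abelian $p$-group with $|Z(G)| = p$. Suppose that every maximal subgroup of $G$ is non-abelian and that $[Z(M), g] \leq Z(G)$ for every maximal subgroup $M$ of $G$ and every $g \in G \setminus M$. Then $G$ has a non-inner automorphism $\alpha$ of order $p$ such that $\alpha(x) = x$ for all $x \in \Phi(G)$.
   Context: $Z(H)$ denotes the center of a group $H$, and $\Phi(G)$ denotes the Frattini subgroup of $G$ (the intersection of all maximal subgroups of $G$). For a maximal subgroup $M$ of $G$ and $g \in G$, the condition $[Z(M), g] \leq Z(G)$ means that $[z,g] \in Z(G)$ for all $z \in Z(M)$, where $[z,g] = z^{-1}g^{-1}zg$ is the commutator. A $p$-group $G$ is called monolithic here if $Z(G)$ is isomorphic to the cyclic group $C_p$ of order $p$. *)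

theory Defs
  imports "HOL-Algebra.Algebra"
begin

definition group_center :: "('a, 'b) monoid_scheme \<Rightarrow> 'a set" where
  "group_center G = {z \<in> carrier G. \<forall>x \<in> carrier G. z \<otimes>\<^bsub>G\<^esub> x = x \<otimes>\<^bsub>G\<^esub> z}"

definition maximal_subgroup :: "'a set \<Rightarrow> ('a, 'b) monoid_scheme \<Rightarrow> bool" where
  "maximal_subgroup M G \<longleftrightarrow> subgroup M G \<and> M \<noteq> carrier G \<and>
     (\<forall>H. subgroup H G \<longrightarrow> M \<subseteq> H \<longrightarrow> H = M \<or> H = carrier G)"

(* The intersection with the carrier only matters when there is no maximal subgroup, in
   which case the Frattini subgroup is the whole group. *)
definition frattini :: "('a, 'b) monoid_scheme \<Rightarrow> 'a set" where
  "frattini G = carrier G \<inter> \<Inter> {M. maximal_subgroup M G}"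

(* The convention [x, y] = x^-1 y^-1 x y; the library's derived_set uses x y x^-1 y^-1. *)
definition group_commutator :: "('a, 'b) monoid_scheme \<Rightarrow> 'a \<Rightarrow> 'a \<Rightarrow> 'a" where
  "group_commutator G x y = inv\<^bsub>G\<^esub> x \<otimes>\<^bsub>G\<^esub> inv\<^bsub>G\<^esub> y \<otimes>\<^bsub>G\<^esub> x \<otimes>\<^bsub>G\<^esub> y"

(* The functions are restricted to the carrier because the elements of auto G are extensional. *)
definition inner_auto :: "('a, 'b) monoid_scheme \<Rightarrow> ('a \<Rightarrow> 'a) set" where
  "inner_auto G = {\<lambda>x \<in> carrier G. g \<otimes>\<^bsub>G\<^esub> x \<otimes>\<^bsub>G\<^esub> inv\<^bsub>G\<^esub> g | g. g \<in> carrier G}"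

definition finite_p_group :: "nat \<Rightarrow> ('a, 'b) monoid_scheme \<Rightarrow> bool" where
  "finite_p_group p G \<longleftrightarrow> group G \<and> finite (carrier G) \<and> (\<exists>n. order G = p ^ n)"

definition monolithic :: "nat \<Rightarrow> ('a, 'b) monoid_scheme \<Rightarrow> bool" where
  "monolithic p G \<longleftrightarrow> G\<lparr>carrier := group_center G\<rparr> \<cong> integer_mod_group p"

lemma subgroup_group_center:
  fixes G (structure)
  assumes "group G" shows "subgroup (group_center G) G"
proof -
  interpret group G by fact
  show ?thesis
  proof (rule subgroupI)
    show "group_center G \<subseteq> carrier G" "group_center G \<noteq> {}"
      by (auto simp: group_center_def)
  next
    fix a assume a: "a \<in> group_center G"
    then have "a \<otimes> x = x \<otimes> a" "a \<in> carrier G" if "x \<in> carrier G" for x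
      using that by (auto simp: group_center_def)
    then have "inv a \<otimes> x = x \<otimes> inv a" if "x \<in> carrier G" for x
      using that by (metis inv_closed inv_solve_left inv_solve_right m_assoc m_closed)
    then show "inv a \<in> group_center G"
      using a by (auto simp: group_center_def)
  next
    fix a b assume "a \<in> group_center G" "b \<in> group_center G"
    then have ab: "a \<in> carrier G" "b \<in> carrier G"
      and comm: "\<And>x. x \<in> carrier G \<Longrightarrow> a \<otimes> x = x \<otimes> a"
        "\<And>x. x \<in> carrier G \<Longrightarrow> b \<otimes> x = x \<otimes> b"
      by (auto simp: group_center_def)
    have "a \<otimes> b \<otimes> x = x \<otimes> (a \<otimes> b)" if x: "x \<in> carrier G" for x
    proof -
      have "a \<otimes> b \<otimes> x = a \<otimes> (x \<otimes> b)"
        using ab x comm(2)[OF x] by (simp add: m_assoc)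
      also have "\<dots> = x \<otimes> a \<otimes> b"
        using ab x comm(1)[OF x] by (simp flip: m_assoc)
      finally show ?thesis
        using ab x by (simp add: m_assoc)
    qed
    then show "a \<otimes> b \<in> group_center G"
      using ab by (simp add: group_center_def)
  qed
qed

lemma monolithic_iff_card_center:
  assumes "group G" "Factorial_Ring.prime p"
  shows "monolithic p G \<longleftrightarrow> card (group_center G) = p"
proof
  have p0: "p > 0" using assms(2) prime_gt_0_nat by blast
  assume "monolithic p G"
  then obtain h where "h \<in> iso (G\<lparr>carrier := group_center G\<rparr>) (integer_mod_group p)"
    by (auto simp: monolithic_def is_iso_def)
  then have "bij_betw h (group_center G) (carrier (integer_mod_group p))"
    by (simp add: iso_def)
  then show "card (group_center G) = p"
    using p0 by (auto dest!: bij_betw_same_card simp: carrier_integer_mod_group)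
next
  assume c: "card (group_center G) = p"
  let ?Z = "G\<lparr>carrier := group_center G\<rparr>"
  interpret Z: group ?Z
    using subgroup.subgroup_is_group[OF subgroup_group_center[OF assms(1)] assms(1)] .
  have p: "p > 1" "p > 0" using assms(2) prime_gt_1_nat prime_gt_0_nat by auto
  have ord: "order ?Z = p" using c by (simp add: order_def)
  have fin: "finite (carrier ?Z)" using c p by (auto intro: card_ge_0_finite)
  obtain x where x: "x \<in> carrier ?Z" "x \<noteq> \<one>\<^bsub>?Z\<^esub>"
  proof -
    have "\<not> carrier ?Z \<subseteq> {\<one>\<^bsub>?Z\<^esub>}"
      using card_mono[of "{\<one>\<^bsub>?Z\<^esub>}" "carrier ?Z"] c p by auto
    then show ?thesis using that by blast
  qed
  have ordx: "Z.ord x = p"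
    using Z.ord_dvd_group_order[OF x(1)] Z.ord_eq_1[OF x(1)] x(2) ord assms(2)
    by (metis prime_nat_iff)
  let ?h = "\<lambda>k::int. x [^]\<^bsub>?Z\<^esub> k"
  have car: "carrier (integer_mod_group p) = {0..<int p}"
    using p by (simp add: carrier_integer_mod_group)
  have h: "?h k \<in> carrier ?Z" for k
    using Z.int_pow_closed[OF x(1)] .
  have inj: "inj_on ?h {0..<int p}"
  proof (rule inj_onI)
    fix i j assume ij: "i \<in> {0..<int p}" "j \<in> {0..<int p}" "?h i = ?h j"
    then have "int p dvd j - i"
      using Z.int_pow_eq[OF x(1), of i j] ordx by simp
    then have "i mod int p = j mod int p"
      by (metis mod_eq_dvd_iff)
    then show "i = j" using ij by simp
  qed
  have "?h ` {0..<int p} = carrier ?Z"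
  proof (rule card_subset_eq[OF fin])
    show "?h ` {0..<int p} \<subseteq> carrier ?Z" using h by blast
    show "card (?h ` {0..<int p}) = card (carrier ?Z)"
      using card_image[OF inj] c by simp
  qed
  with inj have bij: "bij_betw ?h {0..<int p} (carrier ?Z)"
    by (simp add: bij_betw_def)
  have "?h ((i + j) mod int p) = ?h i \<otimes>\<^bsub>?Z\<^esub> ?h j" for i j
  proof -
    have "?h ((i + j) mod int p) = ?h (i + j)"
      using Z.int_pow_eq[OF x(1)] ordx by (simp add: mod_eq_dvd_iff[symmetric])
    also have "\<dots> = ?h i \<otimes>\<^bsub>?Z\<^esub> ?h j"
      using Z.int_pow_mult[OF x(1)] .
    finally show ?thesis .
  qed
  then have "?h \<in> iso (integer_mod_group p) ?Z"
    using bij h by (simp add: iso_def hom_def car)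
  then show "monolithic p G"
    unfolding monolithic_def
    using group.iso_sym[OF group_integer_mod_group] is_isoI by blast
qed

end

theory Submission
  imports Defs
begin

text \<open>
  Suppose that every automorphism of order \<open>p\<close> that fixes some maximal subgroup pointwise is
  inner; since the Frattini subgroup lies in all maximal subgroups, it suffices to refute this.

  Let \<open>M\<close> be maximal, \<open>g \<notin> M\<close>, and let \<open>u \<in> Z(M)\<close> have order \<open>p\<close>. By hypothesis \<open>[u, g]\<close> is central,
  and \<open>p\<close> is odd, so \<open>(g u)\<^sup>p = g\<^sup>p\<close>. As \<open>u\<close> centralizes \<open>M\<close>, both \<open>g\<close> and \<open>g u\<close> act on \<open>M\<close> by the same
  conjugation, and so \<open>m g\<^sup>i \<mapsto> m (g u)\<^sup>i\<close> is an automorphism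
  (\<open>ex_automorphism_fixing_maximal_subgroup\<close>). It has order \<open>p\<close>, hence is inner by assumption,
  which yields \<open>h \<in> Z(M)\<close> with \<open>[h, g] = u\<close> (\<open>inner_fixing_maximal_subgroup\<close>). Applied to \<open>h\<close>, the
  hypothesis \<open>[Z(M), g] \<le> Z(G)\<close> shows that \<open>u\<close> is central. So every element of order \<open>p\<close> in \<open>Z(M)\<close>,
  for any maximal \<open>M\<close>, is central, and the contradiction comes from finding one that is not.

  The centralizer of an element \<open>u\<close> of \<open>Z\<^sub>2(G) - Z(G)\<close> is a maximal subgroup, because \<open>x \<mapsto> [u, x]\<close> is
  a nontrivial homomorphism into a group of order \<open>p\<close> (\<open>centralizer_maximal\<close>); and \<open>u\<close> lies in the
  center of its centralizer. It remains to find such a \<open>u\<close> of order \<open>p\<close>. The construction above,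
  with a generator of \<open>Z(G)\<close> in place of \<open>u\<close>, shows that \<open>Z(M)\<close> contains an element of
  \<open>Z\<^sub>2(G) - Z(G)\<close> for every maximal \<open>M\<close>. Take such elements \<open>h\<close> and \<open>k\<close> for two different maximal
  subgroups. Their \<open>p\<close>-th powers are central and the \<open>p\<close>-th power map is multiplicative on \<open>Z\<^sub>2(G)\<close>,
  so that one of \<open>h\<close> and \<open>k h\<^sup>i\<close> has order \<open>p\<close>; and \<open>k h\<^sup>i\<close> is not central since \<open>h\<close> and \<open>k\<close> have
  different centralizers (\<open>ex_order_p_in_second_center\<close>).
\<close>

section \<open>Fixed points of p-group actions\<close>

lemma (in group) group_actionI:
  assumes closed: "\<And>g x. g \<in> carrier G \<Longrightarrow> x \<in> E \<Longrightarrow> f g x \<in> E"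
    and one: "\<And>x. x \<in> E \<Longrightarrow> f \<one> x = x"
    and mult: "\<And>g h x. g \<in> carrier G \<Longrightarrow> h \<in> carrier G \<Longrightarrow> x \<in> E \<Longrightarrow> f (g \<otimes> h) x = f g (f h x)"
  shows "group_action G E (\<lambda>g. \<lambda>x\<in>E. f g x)"
proof -
  have bij: "(\<lambda>x\<in>E. f g x) \<in> Bij E" if g: "g \<in> carrier G" for g
  proof -
    have "bij_betw (\<lambda>x\<in>E. f g x) E E"
    proof (rule bij_betw_byWitness[where f' = "f (inv g)"])
      show "\<forall>x\<in>E. f (inv g) ((\<lambda>x\<in>E. f g x) x) = x" "\<forall>x\<in>E. (\<lambda>x\<in>E. f g x) (f (inv g) x) = x"
        using g by (simp_all add: closed one flip: mult)
    qed (use g closed in auto)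
    then show ?thesis by (simp add: Bij_def)
  qed
  have "(\<lambda>x\<in>E. f (g \<otimes> h) x) = compose E (\<lambda>x\<in>E. f g x) (\<lambda>x\<in>E. f h x)"
    if "g \<in> carrier G" "h \<in> carrier G" for g h
    using that by (auto simp: compose_def mult closed)
  then show ?thesis
    unfolding group_action_def group_hom_def group_hom_axioms_def
    using bij group_BijGroup[of E]
    by (simp add: hom_def is_group) (simp add: BijGroup_def Pi_iff)
qed

text \<open>
  An orbit that is not a single fixed point has a size which divides a power of \<open>p\<close> and exceeds
  \<open>1\<close>, hence is divisible by \<open>p\<close>.
\<close>

lemma (in group_action) card_fixed_points_mod_prime:
  assumes p: "Factorial_Ring.prime p" and n: "order G = p ^ n" and fin: "finite E"
  shows "card {x \<in> E. \<forall>g \<in> carrier G. \<phi> g x = x} mod p = card E mod p"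
proof -
  interpret group G using group_hom group_hom.axioms(1) by blast
  let ?F = "{x \<in> E. \<forall>g \<in> carrier G. \<phi> g x = x}"
  let ?O = "orbits G E \<phi>"
  have finO: "finite ?O" using fin by (simp add: orbits_def)
  have single: "orbit G \<phi> x = {x} \<longleftrightarrow> (\<forall>g \<in> carrier G. \<phi> g x = x)" for x
  proof
    assume "\<forall>g \<in> carrier G. \<phi> g x = x"
    then have "orbit G \<phi> x = (\<lambda>_. x) ` carrier G" by (force simp: orbit_def)
    then show "orbit G \<phi> x = {x}" using one_closed by blast
  qed (auto simp: orbit_def)
  have F: "{Q \<in> ?O. card Q = 1} = (\<lambda>x. {x}) ` ?F"
  proof (intro equalityI subsetI)
    fix Q assume "Q \<in> {Q \<in> ?O. card Q = 1}"
    then obtain x where x: "x \<in> E" "Q = orbit G \<phi> x" "card Q = 1" by (auto simp: orbits_def)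
    then have "Q = {x}" using orbit_refl[OF x(1)] by (metis card_1_singletonE singletonD)
    then show "Q \<in> (\<lambda>x. {x}) ` ?F" using x single[of x] by auto
  next
    fix Q assume "Q \<in> (\<lambda>x. {x}) ` ?F"
    then obtain x where "x \<in> E" "\<forall>g \<in> carrier G. \<phi> g x = x" "Q = {x}" by auto
    then show "Q \<in> {Q \<in> ?O. card Q = 1}" using single[of x] by (auto simp: orbits_def)
  qed
  have cardF: "card {Q \<in> ?O. card Q = 1} = card ?F"
    unfolding F by (rule card_image) (auto simp: inj_on_def)
  have rest: "p dvd (\<Sum>Q \<in> {Q \<in> ?O. card Q \<noteq> 1}. card Q)"
  proof (rule dvd_sum)
    fix Q assume "Q \<in> {Q \<in> ?O. card Q \<noteq> 1}"
    then obtain x where x: "x \<in> E" "Q = orbit G \<phi> x" "card Q \<noteq> 1" by (auto simp: orbits_def)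
    then have "card Q dvd p ^ n" using orbit_stabilizer_theorem[OF x(1)] n by (metis dvd_triv_left)
    then obtain i where "card Q = p ^ i" using p by (auto simp: divides_primepow_nat)
    then show "p dvd card Q" using x(3) by (cases i) auto
  qed
  have "card E = (\<Sum>Q \<in> ?O. card Q)"
    using disjoint_sum[OF fin, of "\<lambda>_. 1::nat"] by simp
  also have "?O = {Q \<in> ?O. card Q = 1} \<union> {Q \<in> ?O. card Q \<noteq> 1}" by blast
  also have "(\<Sum>Q \<in> \<dots>. card Q) = card ?F + (\<Sum>Q \<in> {Q \<in> ?O. card Q \<noteq> 1}. card Q)"
    using finO cardF by (subst sum.union_disjoint) auto
  finally have "card E = card ?F + (\<Sum>Q \<in> {Q \<in> ?O. card Q \<noteq> 1}. card Q)" .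
  then show ?thesis using rest by (auto elim!: dvdE)
qed

locale p_group = group +
  fixes p :: nat
  assumes prime_p: "Factorial_Ring.prime p"
    and finite_carrier: "finite (carrier G)"
    and order_p_power: "\<exists>n. order G = p ^ n"
begin

lemma p_gt_1: "p > 1" using prime_p by (rule prime_gt_1_nat)

lemma subgroup_p_group:
  assumes "subgroup H G" shows "p_group (G\<lparr>carrier := H\<rparr>) p"
proof -
  interpret H: group "G\<lparr>carrier := H\<rparr>" using assms subgroup.subgroup_is_group is_group by blast
  obtain n where "order G = p ^ n" using order_p_power by blast
  then have "card H dvd p ^ n" using lagrange[OF assms] by (metis dvd_triv_right)
  then obtain k where "card H = p ^ k" using prime_p by (auto simp: divides_primepow_nat)
  moreover have "finite H" using assms finite_carrier subgroup.subset finite_subset by blast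
  ultimately show ?thesis
    using prime_p by unfold_locales (auto simp: order_def)
qed

lemma another_fixed_point:
  assumes "group_action G E \<phi>" and fin: "finite E" and "p dvd card E"
    and x: "x \<in> E" "\<And>g. g \<in> carrier G \<Longrightarrow> \<phi> g x = x"
  obtains y where "y \<in> E" "y \<noteq> x" "\<And>g. g \<in> carrier G \<Longrightarrow> \<phi> g y = y"
proof -
  let ?F = "{x \<in> E. \<forall>g \<in> carrier G. \<phi> g x = x}"
  have "p dvd card ?F"
    using group_action.card_fixed_points_mod_prime[OF assms(1) prime_p _ fin] order_p_power
      \<open>p dvd card E\<close> by (metis (no_types, lifting) dvd_eq_mod_eq_0)
  then have "card ?F \<noteq> 1" using p_gt_1 by auto
  moreover have "x \<in> ?F" using x by blast
  ultimately have "?F \<noteq> {x}" by force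
  then show thesis using \<open>x \<in> ?F\<close> that by blast
qed

end

section \<open>Maximal subgroups of finite p-groups\<close>

context p_group
begin

text \<open>
  Let \<open>M\<close> act on its right cosets by right multiplication. Their number is a multiple of \<open>p\<close> and
  the coset \<open>M\<close> is fixed, so another coset \<open>M a\<close> is fixed as well. This says that \<open>a \<notin> M\<close>
  normalizes \<open>M\<close>, and by maximality the normalizer is the whole group.
\<close>

lemma maximal_subgroup_normal:
  assumes "maximal_subgroup M G" shows "M \<lhd> G"
proof -
  have sub: "subgroup M G" and proper: "M \<noteq> carrier G"
    and max: "\<And>H. subgroup H G \<Longrightarrow> M \<subseteq> H \<Longrightarrow> H = M \<or> H = carrier G"
    using assms by (auto simp: maximal_subgroup_def)
  interpret M: subgroup M G by fact
  interpret P: p_group "G\<lparr>carrier := M\<rparr>" p by (rule subgroup_p_group[OF sub])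
  \<comment> \<open>The inverse turns right multiplication into a left action.\<close>
  have act: "group_action (G\<lparr>carrier := M\<rparr>) (rcosets M) (\<lambda>g. \<lambda>C\<in>rcosets M. C #> inv g)"
  proof (rule P.group_actionI)
    show "C #> inv g \<in> rcosets M" if "g \<in> carrier (G\<lparr>carrier := M\<rparr>)" "C \<in> rcosets M" for g C
      using that by (auto simp: RCOSETS_def coset_mult_assoc M.subset)
  next
    show "C #> inv \<one>\<^bsub>G\<lparr>carrier := M\<rparr>\<^esub> = C" if "C \<in> rcosets M" for C
      using that by (auto simp: RCOSETS_def coset_mult_assoc M.subset)
  next
    show "C #> inv (g \<otimes>\<^bsub>G\<lparr>carrier := M\<rparr>\<^esub> h) = (C #> inv h) #> inv g"
      if "g \<in> carrier (G\<lparr>carrier := M\<rparr>)" "h \<in> carrier (G\<lparr>carrier := M\<rparr>)" "C \<in> rcosets M" for g h C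
      using that by (auto simp: RCOSETS_def coset_mult_assoc M.subset inv_mult_group m_assoc)
  qed
  have finR: "finite (rcosets M)"
    using finite_carrier by (simp add: RCOSETS_def)
  have "p dvd card (rcosets M)"
  proof -
    obtain n where n: "order G = p ^ n" using order_p_power by blast
    then have "card (rcosets M) dvd p ^ n" using lagrange[OF sub] by (metis dvd_triv_left)
    then obtain i where i: "card (rcosets M) = p ^ i" using prime_p by (auto simp: divides_primepow_nat)
    have "card (rcosets M) \<noteq> 1"
      using lagrange[OF sub] proper card_subset_eq[OF finite_carrier M.subset] by (auto simp: order_def)
    then show ?thesis using i by (cases i) auto
  qed
  moreover have "M \<in> rcosets M" by (rule M.subgroup_in_rcosets[OF is_group])
  ultimately obtain C where "C \<in> rcosets M" "C \<noteq> M"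
    and "\<And>g. g \<in> M \<Longrightarrow> (\<lambda>C\<in>rcosets M. C #> inv g) C = C"
  proof (elim P.another_fixed_point[OF act finR, of M])
    show "(\<lambda>C\<in>rcosets M. C #> inv g) M = M"
      if "M \<in> rcosets M" "g \<in> carrier (G\<lparr>carrier := M\<rparr>)" for g
      using that coset_join2[OF _ sub, of "inv g"] by simp
  qed auto
  then have C: "C \<in> rcosets M" "C \<noteq> M" "\<And>g. g \<in> M \<Longrightarrow> C #> inv g = C" by auto
  then obtain a where a: "a \<in> carrier G" "C = M #> a" by (auto simp: RCOSETS_def)
  have aM: "a \<notin> M" using C a coset_join2[OF a(1) sub] by blast
  have conj: "a \<otimes> h \<otimes> inv a \<in> M" if h: "h \<in> M" for h
  proof -
    have "M #> a = (M #> a) #> h"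
      using C(3)[of "inv h"] h a M.m_inv_closed[OF h] M.mem_carrier[OF h] by simp
    also have "\<dots> = M #> (a \<otimes> h)" using a h M.mem_carrier by (simp add: coset_mult_assoc M.subset)
    finally have "M #> (a \<otimes> h \<otimes> inv a) = M"
      using a h M.mem_carrier coset_mult_inv2[of M "a \<otimes> h" a] M.subset by simp
    then show ?thesis using coset_join1[OF _ _ sub] a h M.mem_carrier by simp
  qed
  have "a <# M #> inv a = (\<lambda>h. a \<otimes> h \<otimes> inv a) ` M" by (auto simp: l_coset_def r_coset_def)
  also have "\<dots> = M"
  proof (rule card_subset_eq)
    show "finite M" by (rule finite_subset[OF M.subset finite_carrier])
    show "(\<lambda>h. a \<otimes> h \<otimes> inv a) ` M \<subseteq> M" using conj by blast
    have "inj_on (\<lambda>h. a \<otimes> h \<otimes> inv a) M"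
    proof (rule inj_onI)
      fix h k assume "h \<in> M" "k \<in> M" "a \<otimes> h \<otimes> inv a = a \<otimes> k \<otimes> inv a"
      then show "h = k" using conjugation_is_inj[of a h k] a(1) M.mem_carrier by simp
    qed
    then show "card ((\<lambda>h. a \<otimes> h \<otimes> inv a) ` M) = card M" by (rule card_image)
  qed
  finally have aN: "a \<in> normalizer G M"
    unfolding normalizer_def stabilizer_def using a(1) M.subset by simp
  have N: "M \<lhd> G\<lparr>carrier := normalizer G M\<rparr>" by (rule subgroup_in_normalizer[OF sub])
  then have "M \<subseteq> normalizer G M"
    using normal_imp_subgroup subgroup.subset by fastforce
  then have "normalizer G M = carrier G"
    using max[OF normalizer_imp_subgroup[OF M.subset]] aN aM by blast
  then show ?thesis using N by simp
qed

lemma int_pow_is_nat_pow: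
  assumes g: "g \<in> carrier G"
  shows "\<exists>n::nat. g [^] (k::int) = g [^] n"
proof
  have pos: "int (ord g) > 0" using ord_ge_1[OF finite_carrier g] by simp
  have "g [^] k = g [^] (k mod int (ord g))"
    using int_pow_eq[OF g] by (simp add: mod_eq_dvd_iff[symmetric])
  also have "\<dots> = g [^] nat (k mod int (ord g))"
    using pos int_pow_int[of G g "nat (k mod int (ord g))"] by simp
  finally show "g [^] k = g [^] nat (k mod int (ord g))" .
qed

text \<open>
  The product of \<open>M\<close>, which is normal, and \<open>\<langle>g\<rangle>\<close> is a subgroup larger than \<open>M\<close>.
\<close>

lemma maximal_subgroup_decomposition:
  assumes M: "maximal_subgroup M G" and g: "g \<in> carrier G" "g \<notin> M" and x: "x \<in> carrier G"
  obtains m and i :: nat where "m \<in> M" "x = m \<otimes> g [^] i"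
proof -
  interpret M: normal M G by (rule maximal_subgroup_normal[OF M])
  let ?H = "M <#> generate G {g}"
  have prod: "m \<otimes> h \<in> ?H" if "m \<in> M" "h \<in> generate G {g}" for m h
    using that unfolding set_mult_def by blast
  have "subgroup ?H G"
    using g by (intro mult_norm_subgroup M.normal_axioms generate_is_subgroup) auto
  moreover have "M \<subseteq> ?H"
  proof
    show "m \<in> ?H" if "m \<in> M" for m using prod[OF that generate.one] M.mem_carrier[OF that] by simp
  qed
  ultimately have "?H = M \<or> ?H = carrier G" using M by (simp add: maximal_subgroup_def)
  moreover have "g \<in> ?H" using prod[OF M.one_closed generate.incl[of g]] g by simp
  ultimately have "?H = carrier G" using g by metis
  then obtain m k where m: "m \<in> M" "x = m \<otimes> g [^] (k::int)"
    using x unfolding set_mult_def generate_pow[OF g(1)] by blast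
  moreover obtain n :: nat where "g [^] k = g [^] n" using int_pow_is_nat_pow[OF g(1)] by blast
  ultimately show thesis using that by simp
qed

text \<open>
  Otherwise \<open>M\<close> and \<open>g\<^sup>p\<close> generate the group, so that \<open>g \<in> M g\<^bsup>pk\<^esup>\<close> for some \<open>k\<close> and \<open>M\<close> contains
  \<open>g\<^bsup>1-pk\<^esup>\<close>. The exponent is prime to the order of \<open>g\<close>, so \<open>g \<in> M\<close>, which is absurd.
\<close>

lemma pow_p_mem_maximal_subgroup:
  assumes M: "maximal_subgroup M G" and g: "g \<in> carrier G"
  shows "g [^] p \<in> M"
proof (rule ccontr)
  assume gp: "g [^] p \<notin> M"
  have sub: "subgroup M G" using M by (simp add: maximal_subgroup_def)
  interpret M: subgroup M G by (rule sub)
  obtain m k where m: "m \<in> M" and gk: "g = m \<otimes> (g [^] p) [^] (k::nat)"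
    using maximal_subgroup_decomposition[OF M _ gp g] g by blast
  let ?q = "1 - int p * int k"
  have "(g [^] p) [^] k = g [^] (int p * int k)" 
    by (simp only: of_nat_mult[symmetric] int_pow_int nat_pow_pow[OF g])
  then have "m = g \<otimes> inv (g [^] (int p * int k))"
    using gk m g M.mem_carrier by (metis inv_solve_right int_pow_closed)
  then have gM: "g [^] ?q \<in> M" using m g by (simp add: int_pow_diff)
  obtain n where n: "order G = p ^ n" using order_p_power by blast
  have "coprime ?q (int p)"
  proof (rule coprimeI)
    fix c assume "c dvd ?q" "c dvd int p"
    then have "c dvd ?q + int p * int k" by (metis dvd_add dvd_mult2)
    then show "is_unit c" by simp
  qed
  then have "gcd ?q (int p ^ n) = 1" by (simp add: coprime_imp_gcd_eq_1)
  then obtain a b where ab: "a * ?q + b * int p ^ n = 1"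
    using bezout_int[of ?q "int p ^ n"] by metis
  have "g [^] (int p ^ n * b) = \<one>"
  proof -
    have "g [^] (int p ^ n * b) = (g [^] int (p ^ n)) [^] b" using g by (simp add: int_pow_pow del: int_pow_int)
    then show ?thesis using pow_order_eq_1[OF g] n by (simp only: int_pow_int) simp
  qed
  moreover have "g [^] (?q * a + int p ^ n * b) = (g [^] ?q) [^] a \<otimes> g [^] (int p ^ n * b)"
    using g by (simp add: int_pow_mult int_pow_pow)
  moreover have "?q * a + int p ^ n * b = 1" using ab by (simp add: mult.commute)
  ultimately have "g = (g [^] ?q) [^] a" using g by simp
  then have "g \<in> M" using subgroup_int_pow_closed[OF sub gM, of a] by simp
  then have "g [^] p \<in> M" using subgroup_int_pow_closed[OF sub, of g "int p"] by (simp add: int_pow_int)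
  with gp show False ..
qed

text \<open>
  The quotient by \<open>M\<close> is generated by the image of \<open>g\<close> and has order \<open>p\<close>. Bezout coefficients
  avoid forming it.
\<close>

lemma pow_mem_maximal_subgroup_iff:
  assumes M: "maximal_subgroup M G" and g: "g \<in> carrier G" "g \<notin> M"
  shows "g [^] (i::nat) \<in> M \<longleftrightarrow> p dvd i"
proof
  have sub: "subgroup M G" using M by (simp add: maximal_subgroup_def)
  have gp: "g [^] p \<in> M" by (rule pow_p_mem_maximal_subgroup[OF M g(1)])
  show "g [^] i \<in> M" if "p dvd i"
  proof -
    obtain j where "i = p * j" using \<open>p dvd i\<close> by blast
    then show ?thesis
      using subgroup_int_pow_closed[OF sub gp, of "int j"] g by (simp add: int_pow_int nat_pow_pow)
  qed
  show "p dvd i" if gi: "g [^] i \<in> M"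
  proof (rule ccontr)
    assume "\<not> p dvd i"
    then have "coprime (int i) (int p)"
      using prime_imp_coprime[OF prime_p] by (simp add: coprime_commute)
    then obtain a b where ab: "a * int i + b * int p = 1"
      using bezout_int[of "int i" "int p"] by (metis coprime_imp_gcd_eq_1)
    have "g = g [^] (int i * a + int p * b)" using ab g by (simp add: mult.commute)
    also have "\<dots> = (g [^] int i) [^] a \<otimes> (g [^] int p) [^] b"
      using g by (simp add: int_pow_mult int_pow_pow del: int_pow_int)
    also have "\<dots> = (g [^] i) [^] a \<otimes> (g [^] p) [^] b"
      by (simp add: int_pow_int)
    also have "\<dots> \<in> M"
      by (intro subgroup.m_closed[OF sub] subgroup_int_pow_closed[OF sub] gi gp)
    finally show False using g by simp
  qed
qed

text \<open>
  The fixed points of conjugation on \<open>N\<close> are the central elements of \<open>N\<close>. The identity is one of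
  them, and their number is a multiple of \<open>p\<close>.
\<close>

lemma normal_meets_center:
  assumes N: "N \<lhd> G" and nontriv: "N \<noteq> {\<one>}"
  obtains z where "z \<in> N" "z \<in> group_center G" "z \<noteq> \<one>"
proof -
  interpret N: normal N G by (rule N)
  have act: "group_action G N (\<lambda>g. \<lambda>x\<in>N. g \<otimes> x \<otimes> inv g)"
  proof (rule group_actionI)
    show "g \<otimes> x \<otimes> inv g \<in> N" if "g \<in> carrier G" "x \<in> N" for g x
      using that by (rule N.inv_op_closed2)
  qed (simp_all add: N.mem_carrier inv_mult_group m_assoc)
  obtain n where n: "order G = p ^ n" using order_p_power by blast
  then have "card N dvd p ^ n" using lagrange[OF N.subgroup_axioms] by (metis dvd_triv_right)
  then obtain i where i: "card N = p ^ i" using prime_p by (auto simp: divides_primepow_nat)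
  have "card N \<noteq> 1" using nontriv N.one_closed by (metis card_1_singletonE singletonD)
  then have "p dvd card N" using i by (cases i) auto
  moreover have "finite N" by (rule finite_subset[OF N.subset finite_carrier])
  moreover have "(\<lambda>x\<in>N. g \<otimes> x \<otimes> inv g) \<one> = \<one>" if "g \<in> carrier G" for g
    using that N.one_closed by simp
  ultimately obtain z where z: "z \<in> N" "z \<noteq> \<one>"
    "\<And>g. g \<in> carrier G \<Longrightarrow> (\<lambda>x\<in>N. g \<otimes> x \<otimes> inv g) z = z"
    using another_fixed_point[OF act _ _ N.one_closed] by blast
  then have "g \<otimes> z \<otimes> inv g = z" if "g \<in> carrier G" for g using that by simp
  then have "z \<otimes> g = g \<otimes> z" if "g \<in> carrier G" for g
    using that z(1) N.mem_carrier by (metis inv_solve_right' m_closed)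
  then have "z \<in> group_center G" using z(1) N.mem_carrier by (simp add: group_center_def)
  with z show thesis using that by blast
qed

lemma ex_maximal_subgroup:
  assumes "subgroup H G" "H \<noteq> carrier G"
  obtains M where "maximal_subgroup M G" "H \<subseteq> M"
proof -
  let ?S = "{K. subgroup K G \<and> K \<noteq> carrier G}"
  have "finite ?S"
    by (rule finite_subset[of _ "Pow (carrier G)"]) (auto simp: finite_carrier dest: subgroup.subset)
  moreover have "H \<in> ?S" using assms by simp
  ultimately have "\<exists>M\<in>?S. H \<subseteq> M \<and> (\<forall>K\<in>?S. M \<subseteq> K \<longrightarrow> M = K)"
    by (rule finite_has_maximal2)
  then obtain M where M: "subgroup M G" "M \<noteq> carrier G" "H \<subseteq> M"
    and max: "\<forall>K\<in>?S. M \<subseteq> K \<longrightarrow> M = K" by auto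
  from M(1,2) max have "maximal_subgroup M G" unfolding maximal_subgroup_def by auto
  then show thesis using M(3) that by simp
qed

lemma comm_group_if_powers:
  assumes g: "g \<in> carrier G" and pow: "\<And>x. x \<in> carrier G \<Longrightarrow> \<exists>i::nat. x = g [^] i"
  shows "comm_group G"
proof (rule group_comm_groupI)
  fix x y assume "x \<in> carrier G" "y \<in> carrier G"
  then obtain i j :: nat where "x = g [^] i" "y = g [^] j" using pow by blast
  then show "x \<otimes> y = y \<otimes> x" using g by (simp add: nat_pow_mult add.commute)
qed

text \<open>
  A nonabelian group is not cyclic, so an element outside one maximal subgroup generates a proper
  subgroup, and this lies in another one.
\<close>

lemma ex_two_maximal_subgroups:
  assumes "\<not> comm_group G"
  obtains M N where "maximal_subgroup M G" "maximal_subgroup N G" "M \<noteq> N"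
proof -
  have noncyclic: "generate G {x} \<noteq> carrier G" if x: "x \<in> carrier G" for x
  proof
    assume gen: "generate G {x} = carrier G"
    have "\<exists>i::nat. y = x [^] i" if "y \<in> carrier G" for y
    proof -
      have "y \<in> {x [^] (k::int) | k. k \<in> UNIV}" using that unfolding gen[symmetric] generate_pow[OF x] .
      then show ?thesis using int_pow_is_nat_pow[OF x] by auto
    qed
    then show False using assms comm_group_if_powers[OF x] by blast
  qed
  obtain M where M: "maximal_subgroup M G"
    using ex_maximal_subgroup[OF generate_is_subgroup noncyclic] by blast
  then have "M \<subseteq> carrier G" "M \<noteq> carrier G"
    using subgroup.subset by (auto simp: maximal_subgroup_def)
  then obtain x where x: "x \<in> carrier G" "x \<notin> M" by blast
  then obtain N where N: "maximal_subgroup N G" "generate G {x} \<subseteq> N"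
    using ex_maximal_subgroup[OF generate_is_subgroup noncyclic[OF x(1)]] by blast
  have "x \<in> N" using N(2) generate.incl[of x "{x}" G] by blast
  then show thesis using that[OF M N(1)] x(2) by blast
qed

lemma maximal_subgroup_nontrivial:
  assumes "\<not> comm_group G" and M: "maximal_subgroup M G"
  shows "M \<noteq> {\<one>}"
proof
  assume triv: "M = {\<one>}"
  have "M \<subseteq> carrier G" "M \<noteq> carrier G"
    using M subgroup.subset by (auto simp: maximal_subgroup_def)
  then obtain g where g: "g \<in> carrier G" "g \<notin> M" by blast
  have "\<exists>i::nat. x = g [^] i" if "x \<in> carrier G" for x
    using maximal_subgroup_decomposition[OF M g that] g triv by (metis l_one nat_pow_closed singletonD)
  then show False using comm_group_if_powers[OF g(1)] assms(1) by blast
qed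

end

section \<open>Commutators and the second center\<close>

lemma center_of_subgroup [simp]:
  "group_center (G\<lparr>carrier := M\<rparr>) = {z \<in> M. \<forall>x \<in> M. z \<otimes>\<^bsub>G\<^esub> x = x \<otimes>\<^bsub>G\<^esub> z}"
  by (simp add: group_center_def)

definition centralizer :: "('a, 'b) monoid_scheme \<Rightarrow> 'a \<Rightarrow> 'a set" where
  "centralizer G u = {x \<in> carrier G. u \<otimes>\<^bsub>G\<^esub> x = x \<otimes>\<^bsub>G\<^esub> u}"

definition second_center :: "('a, 'b) monoid_scheme \<Rightarrow> 'a set" where
  "second_center G = {u \<in> carrier G. \<forall>x \<in> carrier G. group_commutator G u x \<in> group_center G}"

context group begin

lemma centralizer_subgroup:
  assumes u: "u \<in> carrier G" shows "subgroup (centralizer G u) G"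
proof (rule subgroupI)
  show "centralizer G u \<subseteq> carrier G" "centralizer G u \<noteq> {}"
    using u one_closed by (auto simp: centralizer_def)
next
  fix a assume "a \<in> centralizer G u"
  then have a: "a \<in> carrier G" "u \<otimes> a = a \<otimes> u" by (auto simp: centralizer_def)
  then have "inv a \<otimes> u = u \<otimes> inv a"
    using u by (metis inv_closed inv_solve_left inv_solve_right m_assoc m_closed)
  then show "inv a \<in> centralizer G u" using a by (simp add: centralizer_def)
next
  fix a b assume "a \<in> centralizer G u" "b \<in> centralizer G u"
  then have a: "a \<in> carrier G" "u \<otimes> a = a \<otimes> u" and b: "b \<in> carrier G" "u \<otimes> b = b \<otimes> u"
    by (auto simp: centralizer_def)
  have "u \<otimes> (a \<otimes> b) = a \<otimes> u \<otimes> b" using m_assoc[OF u a(1) b(1)] a(2) by simp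
  also have "\<dots> = a \<otimes> (b \<otimes> u)" using m_assoc[OF a(1) u b(1)] b(2) by simp
  also have "\<dots> = a \<otimes> b \<otimes> u" using m_assoc[OF a(1) b(1) u] by simp
  finally show "a \<otimes> b \<in> centralizer G u" using a b by (simp add: centralizer_def)
qed

lemma centralizer_eq_carrier_iff:
  "u \<in> carrier G \<Longrightarrow> centralizer G u = carrier G \<longleftrightarrow> u \<in> group_center G"
  by (auto simp: centralizer_def group_center_def)

lemma commutator_closed [simp]:
  "x \<in> carrier G \<Longrightarrow> y \<in> carrier G \<Longrightarrow> group_commutator G x y \<in> carrier G"
  by (simp add: group_commutator_def)

text \<open>
  This replaces calculations with inverses by the rule for moving \<open>u\<close> past \<open>x\<close>.
\<close>

lemma commutator_eq_iff:
  assumes "u \<in> carrier G" "x \<in> carrier G" "c \<in> carrier G"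
  shows "group_commutator G u x = c \<longleftrightarrow> u \<otimes> x = x \<otimes> u \<otimes> c"
proof -
  have "group_commutator G u x = inv (x \<otimes> u) \<otimes> (u \<otimes> x)"
    using assms by (simp add: group_commutator_def inv_mult_group m_assoc)
  moreover have "inv (x \<otimes> u) \<otimes> (u \<otimes> x) = c \<longleftrightarrow> u \<otimes> x = x \<otimes> u \<otimes> c"
    using assms inv_solve_left'[of c "x \<otimes> u" "u \<otimes> x"] by simp
  ultimately show ?thesis by simp
qed

lemma commutator_swap:
  assumes "u \<in> carrier G" "x \<in> carrier G"
  shows "u \<otimes> x = x \<otimes> u \<otimes> group_commutator G u x"
  using commutator_eq_iff[OF assms commutator_closed[OF assms]] by simp

lemma commutator_eq_one_iff:
  assumes "u \<in> carrier G" "x \<in> carrier G"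
  shows "group_commutator G u x = \<one> \<longleftrightarrow> x \<in> centralizer G u"
  using assms by (simp add: commutator_eq_iff centralizer_def)

lemma central_commute:
  assumes "c \<in> group_center G" "x \<in> carrier G"
  shows "c \<otimes> x = x \<otimes> c"
  using assms by (simp add: group_center_def)

lemma central_closed: "c \<in> group_center G \<Longrightarrow> c \<in> carrier G"
  by (simp add: group_center_def)

lemma commutator_mult_right:
  assumes u: "u \<in> carrier G" and x: "x \<in> carrier G" and y: "y \<in> carrier G"
    and a: "group_commutator G u x \<in> group_center G"
  shows "group_commutator G u (x \<otimes> y) = group_commutator G u x \<otimes> group_commutator G u y"
proof -
  let ?a = "group_commutator G u x" and ?b = "group_commutator G u y"
  have [simp]: "?a \<in> carrier G" "?b \<in> carrier G" using u x y by simp_all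
  have "u \<otimes> (x \<otimes> y) = x \<otimes> u \<otimes> ?a \<otimes> y"
    using u x y commutator_swap[OF u x] by (simp flip: m_assoc)
  also have "\<dots> = x \<otimes> (u \<otimes> y) \<otimes> ?a"
    using u x y central_commute[OF a y] by (simp add: m_assoc)
  also have "\<dots> = x \<otimes> (y \<otimes> u \<otimes> ?b) \<otimes> ?a" using commutator_swap[OF u y] by simp
  also have "\<dots> = x \<otimes> y \<otimes> u \<otimes> (?a \<otimes> ?b)"
    using u x y central_commute[OF a, of ?b] by (simp add: m_assoc)
  finally show ?thesis using u x y by (simp add: commutator_eq_iff)
qed

lemma commutator_mult_left:
  assumes u: "u \<in> carrier G" and v: "v \<in> carrier G" and x: "x \<in> carrier G"
    and a: "group_commutator G u x \<in> group_center G"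
  shows "group_commutator G (u \<otimes> v) x = group_commutator G u x \<otimes> group_commutator G v x"
proof -
  let ?a = "group_commutator G u x" and ?b = "group_commutator G v x"
  have [simp]: "?a \<in> carrier G" "?b \<in> carrier G" using u v x by simp_all
  have "u \<otimes> v \<otimes> x = u \<otimes> (x \<otimes> v \<otimes> ?b)"
    using u v x commutator_swap[OF v x] by (simp add: m_assoc)
  also have "\<dots> = (u \<otimes> x) \<otimes> (v \<otimes> ?b)" using u v x by (simp add: m_assoc)
  also have "\<dots> = x \<otimes> u \<otimes> ?a \<otimes> (v \<otimes> ?b)" using commutator_swap[OF u x] by simp
  also have "\<dots> = x \<otimes> u \<otimes> (?a \<otimes> v) \<otimes> ?b" using u v x by (simp add: m_assoc)
  also have "\<dots> = x \<otimes> (u \<otimes> v) \<otimes> (?a \<otimes> ?b)"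
    using u v x central_commute[OF a v] by (simp add: m_assoc)
  finally show ?thesis using u v x by (simp add: commutator_eq_iff)
qed

lemma commutator_pow_right:
  assumes u: "u \<in> carrier G" and x: "x \<in> carrier G"
    and a: "group_commutator G u x \<in> group_center G"
  shows "group_commutator G u (x [^] (n::nat)) = group_commutator G u x [^] n"
proof (induction n)
  case 0
  then show ?case using u by (simp add: commutator_eq_iff)
next
  case (Suc n)
  have "group_commutator G u (x [^] Suc n) = group_commutator G u (x \<otimes> x [^] n)"
    using x by (simp only: nat_pow_Suc2)
  also have "\<dots> = group_commutator G u x [^] Suc n"
    using u x Suc commutator_mult_right[OF u x _ a, of "x [^] n"]
      nat_pow_Suc2[of "group_commutator G u x" n] by simp
  finally show ?case .
qed

lemma commutator_pow_left:
  assumes u: "u \<in> carrier G" and x: "x \<in> carrier G"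
    and a: "group_commutator G u x \<in> group_center G"
  shows "group_commutator G (u [^] (n::nat)) x = group_commutator G u x [^] n"
proof (induction n)
  case 0
  then show ?case using x by (simp add: commutator_eq_iff)
next
  case (Suc n)
  have "group_commutator G (u [^] Suc n) x = group_commutator G (u \<otimes> u [^] n) x"
    using u by (simp only: nat_pow_Suc2)
  also have "\<dots> = group_commutator G u x [^] Suc n"
    using u x Suc commutator_mult_left[OF u _ x a, of "u [^] n"]
      nat_pow_Suc2[of "group_commutator G u x" n] by simp
  finally show ?case .
qed

text \<open>
  Collecting the factors \<open>x\<close> on the left moves one of them past \<open>i\<close> factors \<open>y\<close> for each \<open>i < n\<close>, and
  each such exchange contributes one central commutator.
\<close>

lemma pow_mult_central_commutator:
  assumes x: "x \<in> carrier G" and y: "y \<in> carrier G"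
    and c: "group_commutator G y x \<in> group_center G"
  shows "(x \<otimes> y) [^] (n::nat) = x [^] n \<otimes> y [^] n \<otimes> group_commutator G y x [^] (n choose 2)"
proof (induction n)
  case (Suc n)
  let ?c = "group_commutator G y x" and ?t = "n choose 2"
  have [simp]: "?c \<in> carrier G" using x y by simp
  have swap: "y [^] n \<otimes> x = x \<otimes> y [^] n \<otimes> ?c [^] n"
    using commutator_swap[of "y [^] n" x] commutator_pow_left[OF y x c] x y by simp
  have comm: "?c [^] k \<otimes> w = w \<otimes> ?c [^] k" if "w \<in> carrier G" for w and k :: nat
    using that central_commute[OF c that] by (simp add: group_commutes_pow)
  have "(x \<otimes> y) [^] Suc n = x [^] n \<otimes> y [^] n \<otimes> (?c [^] ?t \<otimes> (x \<otimes> y))"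
    using Suc x y by (simp add: m_assoc)
  also have "\<dots> = x [^] n \<otimes> (y [^] n \<otimes> x) \<otimes> (y \<otimes> ?c [^] ?t)"
    using x y comm[of "x \<otimes> y" ?t] by (simp add: m_assoc)
  also have "\<dots> = x [^] n \<otimes> x \<otimes> y [^] n \<otimes> (?c [^] n \<otimes> y) \<otimes> ?c [^] ?t"
    unfolding swap using x y by (simp add: m_assoc)
  also have "\<dots> = x [^] Suc n \<otimes> y [^] Suc n \<otimes> (?c [^] n \<otimes> ?c [^] ?t)"
    using x y comm[OF y, of n] by (simp add: m_assoc)
  also have "?c [^] n \<otimes> ?c [^] ?t = ?c [^] (Suc n choose 2)"
    by (simp add: nat_pow_mult numeral_2_eq_2)
  finally show ?case .
qed (simp add: numeral_2_eq_2)

end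

lemma (in group) second_center_closed:
  assumes "u \<in> second_center G" "v \<in> second_center G"
  shows "u \<otimes> v \<in> second_center G"
  using assms subgroup.m_closed[OF subgroup_group_center[OF is_group]]
  by (simp add: second_center_def commutator_mult_left)

lemma (in group) second_center_pow_closed:
  assumes u: "u \<in> second_center G"
  shows "u [^] (n::nat) \<in> second_center G"
proof (induction n)
  case 0
  have "group_commutator G \<one> x = \<one>" if "x \<in> carrier G" for x
    using that by (simp add: commutator_eq_iff)
  then show ?case
    using subgroup.one_closed[OF subgroup_group_center[OF is_group]] by (simp add: second_center_def)
next
  case (Suc n)
  then show ?case using second_center_closed[OF Suc u] by simp
qed

section \<open>Automorphisms that fix a maximal subgroup\<close>

context p_group begin

text \<open>
  The map is \<open>m g\<^sup>i \<mapsto> m (g u)\<^sup>i\<close>. It is well defined because \<open>g\<^sup>i\<close> lies in \<open>M\<close> only if \<open>p\<close> divides \<open>i\<close>,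
  and then \<open>(g u)\<^sup>i = g\<^sup>i\<close>. It is multiplicative because \<open>u\<close> centralizes \<open>M\<close>.
\<close>

lemma ex_automorphism_fixing_maximal_subgroup:
  assumes M: "maximal_subgroup M G" and g: "g \<in> carrier G" "g \<notin> M"
    and u: "u \<in> group_center (G\<lparr>carrier := M\<rparr>)" and pow: "(g \<otimes> u) [^] p = g [^] p"
  obtains \<alpha> where "\<alpha> \<in> auto G" "\<And>m. m \<in> M \<Longrightarrow> \<alpha> m = m" "\<alpha> g = g \<otimes> u"
proof -
  interpret M: normal M G by (rule maximal_subgroup_normal[OF M])
  have uM: "u \<in> M" and ucomm: "\<And>m. m \<in> M \<Longrightarrow> u \<otimes> m = m \<otimes> u" using u by auto
  have uc: "u \<in> carrier G" using uM M.mem_carrier by blast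
  define w where "w = g \<otimes> u"
  have w: "w \<in> carrier G" using g uc by (simp add: w_def)
  have wM: "w \<notin> M"
  proof
    assume "w \<in> M"
    then have "w \<otimes> inv u \<in> M" using uM by simp
    then show False using g uc by (simp add: w_def m_assoc)
  qed
  have pow_mult: "w [^] (p * j) = g [^] (p * j)" for j
    using pow g w by (simp add: w_def flip: nat_pow_pow)
  \<comment> \<open>Conjugation by \<open>w\<close> and by \<open>g\<close> agree on \<open>M\<close>, since \<open>w = g u\<close> and \<open>u\<close> centralizes \<open>M\<close>.\<close>
  have conj1: "w \<otimes> m \<otimes> inv w = g \<otimes> m \<otimes> inv g" if m: "m \<in> M" for m
  proof -
    have mc: "m \<in> carrier G" using m by (rule M.mem_carrier)
    have "w \<otimes> m = g \<otimes> (u \<otimes> m)" using g uc mc by (simp add: w_def m_assoc)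
    also have "\<dots> = g \<otimes> m \<otimes> inv g \<otimes> w" using g uc mc ucomm[OF m] by (simp add: w_def m_assoc inv_solve_left)
    finally show ?thesis using g w mc by (simp add: m_assoc)
  qed
  have conj: "w [^] i \<otimes> m \<otimes> inv (w [^] i) = g [^] i \<otimes> m \<otimes> inv (g [^] i)" if "m \<in> M" for m and i :: nat
    using that
  proof (induction i arbitrary: m)
    case (Suc i)
    have mc: "m \<in> carrier G" using Suc.prems by (rule M.mem_carrier)
    have "w [^] Suc i \<otimes> m \<otimes> inv (w [^] Suc i) = w [^] i \<otimes> (w \<otimes> m \<otimes> inv w) \<otimes> inv (w [^] i)"
      using w mc by (simp add: m_assoc inv_mult_group)
    also have "\<dots> = g [^] i \<otimes> (g \<otimes> m \<otimes> inv g) \<otimes> inv (g [^] i)"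
      using Suc.IH[OF M.inv_op_closed2[OF g(1) Suc.prems]] conj1[OF Suc.prems] by simp
    also have "\<dots> = g [^] Suc i \<otimes> m \<otimes> inv (g [^] Suc i)"
      using g mc by (simp add: m_assoc inv_mult_group)
    finally show ?case .
  qed (use M.mem_carrier in simp)
  \<comment> \<open>Independence of the representation; the case \<open>j < i\<close> follows by exchanging the two sides.\<close>
  have well: "m \<otimes> w [^] i = n \<otimes> w [^] j"
    if "m \<in> M" "n \<in> M" "m \<otimes> g [^] i = n \<otimes> g [^] j" "i \<le> j" for m n and i j :: nat
  proof -
    obtain k where k: "j = k + i" using \<open>i \<le> j\<close> by (metis le_add_diff_inverse2)
    have mn: "m \<in> carrier G" "n \<in> carrier G" using that M.mem_carrier by auto
    have "m \<otimes> g [^] i = n \<otimes> g [^] k \<otimes> g [^] i"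
      using that(3) g mn by (simp add: k m_assoc nat_pow_mult)
    then have mk: "m = n \<otimes> g [^] k" using g mn by simp
    then have "g [^] k = inv n \<otimes> m" using g mn by (simp add: inv_solve_left)
    then have "g [^] k \<in> M" using that by simp
    then have "p dvd k" using pow_mem_maximal_subgroup_iff[OF M g] by blast
    then have "w [^] k = g [^] k" using pow_mult by (auto elim!: dvdE)
    then have "m = n \<otimes> w [^] k" using mk by simp
    then show ?thesis using w mn by (simp add: k m_assoc nat_pow_mult)
  qed
  define \<alpha> where "\<alpha> = (\<lambda>x\<in>carrier G. THE y. \<exists>m\<in>M. \<exists>i::nat. x = m \<otimes> g [^] i \<and> y = m \<otimes> w [^] i)"
  have \<alpha>: "\<alpha> (m \<otimes> g [^] i) = m \<otimes> w [^] i" if m: "m \<in> M" for m and i :: nat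
  proof -
    have "(THE y. \<exists>n\<in>M. \<exists>j::nat. m \<otimes> g [^] i = n \<otimes> g [^] j \<and> y = n \<otimes> w [^] j) = m \<otimes> w [^] i"
    proof (rule the_equality)
      fix y assume "\<exists>n\<in>M. \<exists>j::nat. m \<otimes> g [^] i = n \<otimes> g [^] j \<and> y = n \<otimes> w [^] j"
      then obtain n j where "n \<in> M" "m \<otimes> g [^] i = n \<otimes> g [^] (j::nat)" "y = n \<otimes> w [^] j" by blast
      then show "y = m \<otimes> w [^] i"
        using well[of m n i j] well[of n m j i] m by (cases "i \<le> j") auto
    qed (use m in blast)
    then show ?thesis using g m M.mem_carrier by (simp add: \<alpha>_def)
  qed
  have hom: "\<alpha> \<in> hom G G"
  proof (rule homI)
    fix x assume "x \<in> carrier G"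
    then obtain m i where "m \<in> M" "x = m \<otimes> g [^] (i::nat)"
      using maximal_subgroup_decomposition[OF M g] by blast
    then show "\<alpha> x \<in> carrier G" using \<alpha> w M.mem_carrier by simp
  next
    fix x y assume "x \<in> carrier G" "y \<in> carrier G"
    then obtain m n and i j :: nat where
      m: "m \<in> M" and x: "x = m \<otimes> g [^] i" and n: "n \<in> M" and y: "y = n \<otimes> g [^] j"
      using maximal_subgroup_decomposition[OF M g] by metis
    have mn: "m \<in> carrier G" "n \<in> carrier G" using m n M.mem_carrier by auto
    let ?n = "g [^] i \<otimes> n \<otimes> inv (g [^] i)"
    have n': "?n \<in> M" using M.inv_op_closed2[of "g [^] i" n] g n by simp
    have "x \<otimes> y = (m \<otimes> ?n) \<otimes> g [^] (i + j)"
      using g mn by (simp add: x y m_assoc inv_solve_left flip: nat_pow_mult)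
    then have "\<alpha> (x \<otimes> y) = (m \<otimes> ?n) \<otimes> w [^] (i + j)" using \<alpha>[of "m \<otimes> ?n"] m n' by simp
    also have "\<dots> = (m \<otimes> (w [^] i \<otimes> n \<otimes> inv (w [^] i))) \<otimes> w [^] (i + j)"
      using conj[OF n] by simp
    also have "\<dots> = (m \<otimes> w [^] i) \<otimes> (n \<otimes> (inv (w [^] i) \<otimes> w [^] i \<otimes> w [^] j))"
      using w mn by (simp only: m_assoc m_closed inv_closed nat_pow_closed flip: nat_pow_mult)
    also have "\<dots> = (m \<otimes> w [^] i) \<otimes> (n \<otimes> w [^] j)" using w by simp
    finally show "\<alpha> (x \<otimes> y) = \<alpha> x \<otimes> \<alpha> y" using \<alpha> m n by (simp add: x y)
  qed
  interpret \<alpha>: group_hom G G \<alpha> using hom by unfold_locales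
  have "inj_on \<alpha> (carrier G)"
  proof (subst \<alpha>.inj_on_one_iff, intro allI impI)
    fix x assume x: "x \<in> carrier G" "\<alpha> x = \<one>"
    then obtain m i where m: "m \<in> M" and xm: "x = m \<otimes> g [^] (i::nat)"
      using maximal_subgroup_decomposition[OF M g] by blast
    have mc: "m \<in> carrier G" using m M.mem_carrier by blast
    have one: "m \<otimes> w [^] i = \<one>" using x \<alpha>[OF m] xm by simp
    then have "w [^] i = inv m" using w mc by (metis inv_equality inv_inv nat_pow_closed inv_closed)
    then have "w [^] i \<in> M" using m by simp
    then have "p dvd i" using pow_mem_maximal_subgroup_iff[OF M w wM] by blast
    then have "w [^] i = g [^] i" using pow_mult by (auto elim!: dvdE)
    then show "x = \<one>" using one xm by simp
  qed
  then have "bij_betw \<alpha> (carrier G) (carrier G)"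
    using endo_inj_surj[OF finite_carrier, of \<alpha>] \<alpha>.hom_closed unfolding bij_betw_def by blast
  then have "\<alpha> \<in> auto G" using hom by (simp add: auto_def Bij_def \<alpha>_def)
  moreover have "\<alpha> m = m" if "m \<in> M" for m using \<alpha>[OF that, of 0] M.mem_carrier[OF that] by simp
  moreover have "\<alpha> g = g \<otimes> u" using \<alpha>[OF M.one_closed, of 1] g w by (simp add: w_def)
  ultimately show thesis using that by blast
qed

text \<open>
  The \<open>n\<close>-th iterate fixes \<open>M\<close> and sends \<open>g\<close> to \<open>g u\<^sup>n\<close>, since \<open>u \<in> M\<close> is itself fixed.
\<close>

lemma ord_automorphism_fixing_maximal_subgroup:
  assumes M: "maximal_subgroup M G" and g: "g \<in> carrier G" "g \<notin> M"
    and \<alpha>: "\<alpha> \<in> auto G" and fixM: "\<And>m. m \<in> M \<Longrightarrow> \<alpha> m = m" and \<alpha>g: "\<alpha> g = g \<otimes> u"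
    and u: "u \<in> M" "u \<noteq> \<one>" "u [^] p = \<one>"
  shows "group.ord (AutoGroup G) \<alpha> = p"
proof -
  interpret A: group "AutoGroup G" by (rule AutoGroup)
  interpret M: subgroup M G using M by (simp add: maximal_subgroup_def)
  have \<alpha>A: "\<alpha> \<in> carrier (AutoGroup G)" using \<alpha> by (simp add: AutoGroup_def)
  have uc: "u \<in> carrier G" using u M.mem_carrier by blast
  have Bij: "f \<in> Bij (carrier G)" "f \<in> hom G G" if "f \<in> carrier (AutoGroup G)" for f
    using that by (simp_all add: AutoGroup_def auto_def)
  have mult: "(f \<otimes>\<^bsub>AutoGroup G\<^esub> h) x = f (h x)"
    if "f \<in> carrier (AutoGroup G)" "h \<in> carrier (AutoGroup G)" "x \<in> carrier G" for f h x
    using Bij[OF that(1)] Bij[OF that(2)] that(3) by (simp add: AutoGroup_def BijGroup_def compose_def)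
  have one: "\<one>\<^bsub>AutoGroup G\<^esub> x = x" if "x \<in> carrier G" for x
    using that by (simp add: AutoGroup_def BijGroup_def)
  have powM: "(\<alpha> [^]\<^bsub>AutoGroup G\<^esub> n) m = m" if "m \<in> M" for m and n :: nat
    using that by (induction n) (simp_all add: one mult \<alpha>A fixM M.mem_carrier)
  have powg: "(\<alpha> [^]\<^bsub>AutoGroup G\<^esub> n) g = g \<otimes> u [^] n" for n :: nat
  proof (induction n)
    case 0
    then show ?case using g by (simp add: one)
  next
    case (Suc n)
    have h: "\<alpha> [^]\<^bsub>AutoGroup G\<^esub> n \<in> hom G G" using Bij(2) \<alpha>A by simp
    have "(\<alpha> [^]\<^bsub>AutoGroup G\<^esub> Suc n) g = (\<alpha> [^]\<^bsub>AutoGroup G\<^esub> n) (g \<otimes> u)"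
      using g \<alpha>A \<alpha>g by (simp add: mult)
    also have "\<dots> = g \<otimes> u [^] n \<otimes> u" using hom_mult[OF h g(1) uc] Suc powM u by simp
    also have "\<dots> = g \<otimes> u [^] Suc n" using g uc by (simp add: m_assoc)
    finally show ?case .
  qed
  have "\<alpha> [^]\<^bsub>AutoGroup G\<^esub> p = \<one>\<^bsub>AutoGroup G\<^esub>"
  proof (rule extensionalityI[where A = "carrier G"])
    have "\<alpha> [^]\<^bsub>AutoGroup G\<^esub> p \<in> Bij (carrier G)" "\<one>\<^bsub>AutoGroup G\<^esub> \<in> Bij (carrier G)"
      using Bij(1) \<alpha>A by auto
    then show "\<alpha> [^]\<^bsub>AutoGroup G\<^esub> p \<in> extensional (carrier G)"
      "\<one>\<^bsub>AutoGroup G\<^esub> \<in> extensional (carrier G)" by (simp_all add: Bij_def)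
    have h: "\<alpha> [^]\<^bsub>AutoGroup G\<^esub> p \<in> hom G G" using Bij(2) \<alpha>A by simp
    interpret h: group_hom G G "\<alpha> [^]\<^bsub>AutoGroup G\<^esub> p" using h by unfold_locales
    fix x assume x: "x \<in> carrier G"
    then obtain m i where m: "m \<in> M" and xm: "x = m \<otimes> g [^] (i::nat)"
      using maximal_subgroup_decomposition[OF M g] by blast
    have "(\<alpha> [^]\<^bsub>AutoGroup G\<^esub> p) x = x"
      unfolding xm using powg[of p] powM[OF m, of p] u(3) g M.mem_carrier[OF m] by (simp add: h.hom_nat_pow)
    then show "(\<alpha> [^]\<^bsub>AutoGroup G\<^esub> p) x = \<one>\<^bsub>AutoGroup G\<^esub> x" using x one by simp
  qed
  then have "A.ord \<alpha> dvd p" using A.pow_eq_id[OF \<alpha>A] by blast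
  moreover have "A.ord \<alpha> \<noteq> 1"
  proof
    assume "A.ord \<alpha> = 1"
    then have "\<alpha> = \<one>\<^bsub>AutoGroup G\<^esub>" using A.ord_eq_1[OF \<alpha>A] by blast
    then have "g \<otimes> u = g" using one[OF g(1)] \<alpha>g by metis
    then show False using u(2) g uc by simp
  qed
  ultimately show ?thesis using prime_p by (metis prime_nat_iff)
qed

text \<open>
  A conjugating element \<open>h\<close> centralizes \<open>M\<close>. If it lay outside \<open>M\<close>, its centralizer would contain
  \<open>M\<close> and \<open>h\<close> and thus be the whole group, although \<open>h\<close> moves \<open>g\<close>.
\<close>

lemma inner_fixing_maximal_subgroup:
  assumes M: "maximal_subgroup M G" and g: "g \<in> carrier G" "g \<notin> M"
    and \<alpha>: "\<alpha> \<in> inner_auto G" and fixM: "\<And>m. m \<in> M \<Longrightarrow> \<alpha> m = m" and \<alpha>g: "\<alpha> g = g \<otimes> u"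
    and u: "u \<in> M" "u \<noteq> \<one>"
  obtains h where "h \<in> group_center (G\<lparr>carrier := M\<rparr>)" "group_commutator G h g = u"
proof -
  interpret M: subgroup M G using M by (simp add: maximal_subgroup_def)
  have uc: "u \<in> carrier G" using u M.mem_carrier by blast
  obtain h where h: "h \<in> carrier G" and \<alpha>h: "\<And>x. x \<in> carrier G \<Longrightarrow> \<alpha> x = h \<otimes> x \<otimes> inv h"
    using \<alpha> by (auto simp: inner_auto_def)
  have comm: "h \<otimes> m = m \<otimes> h" if "m \<in> M" for m
    using \<alpha>h[of m] fixM[OF that] M.mem_carrier[OF that] h by (metis inv_solve_right' m_closed)
  have hg: "h \<otimes> g = g \<otimes> u \<otimes> h"
    using \<alpha>h[OF g(1)] \<alpha>g h g uc by (metis inv_solve_right' m_closed)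
  also have "\<dots> = g \<otimes> h \<otimes> u" using g uc h comm[OF u(1)] by (simp add: m_assoc)
  finally have c: "group_commutator G h g = u" using h g uc by (simp add: commutator_eq_iff)
  have "h \<in> M"
  proof (rule ccontr)
    assume hM: "h \<notin> M"
    have "M \<subseteq> centralizer G h" "h \<in> centralizer G h"
      using comm M.mem_carrier h by (auto simp: centralizer_def)
    then have "centralizer G h = carrier G"
      using M centralizer_subgroup[OF h] hM by (auto simp: maximal_subgroup_def)
    then have "group_commutator G h g = \<one>" using commutator_eq_one_iff[OF h g(1)] g by simp
    with c u(2) show False by simp
  qed
  then show thesis using that[of h] comm c by simp
qed

end

section \<open>Groups whose center has order p\<close>

locale monolithic_p_group = p_group +
  assumes card_center: "card (group_center G) = p"
begin

lemma center_subgroup: "subgroup (group_center G) G"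
  by (rule subgroup_group_center[OF is_group])

lemma center_pow_p:
  assumes z: "z \<in> group_center G" shows "z [^] p = \<one>"
proof -
  interpret Z: group "G\<lparr>carrier := group_center G\<rparr>"
    using subgroup.subgroup_is_group[OF center_subgroup is_group] .
  show ?thesis using Z.pow_order_eq_1[of z] z card_center by (simp add: order_def flip: nat_pow_consistent)
qed

lemma center_is_powers:
  assumes a: "a \<in> group_center G" "a \<noteq> \<one>" and b: "b \<in> group_center G"
  obtains k :: nat where "b = a [^] k"
proof -
  have ac: "a \<in> carrier G" using a by (rule_tac central_closed)
  interpret Z: group "G\<lparr>carrier := group_center G\<rparr>"
    using subgroup.subgroup_is_group[OF center_subgroup is_group] .
  have sub: "generate G {a} \<subseteq> group_center G"
    using generate_subgroup_incl[OF _ center_subgroup, of "{a}"] a by simp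
  have subZ: "subgroup (generate G {a}) (G\<lparr>carrier := group_center G\<rparr>)"
    using subgroup_incl[OF generate_is_subgroup center_subgroup sub] ac by simp
  have "order (G\<lparr>carrier := group_center G\<rparr>) = p" using card_center by (simp add: order_def)
  then have "card (generate G {a}) dvd p"
    using Z.lagrange[OF subZ] by (metis dvd_triv_right)
  moreover have "card (generate G {a}) \<noteq> 1"
  proof
    assume "card (generate G {a}) = 1"
    then obtain c where "generate G {a} = {c}" by (rule card_1_singletonE)
    then show False using generate.incl[of a "{a}" G] generate.one[of G "{a}"] a(2) by auto
  qed
  ultimately have "card (generate G {a}) = card (group_center G)"
    using prime_p card_center by (metis prime_nat_iff)
  moreover have "finite (group_center G)"
    using finite_subset[OF subgroup.subset[OF center_subgroup] finite_carrier] .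
  ultimately have "generate G {a} = group_center G" using sub by (intro card_subset_eq) auto
  then have "b \<in> {a [^] (k::int) | k. k \<in> UNIV}" using b generate_pow[OF ac] by simp
  then show thesis using int_pow_is_nat_pow[OF ac] that by auto
qed

text \<open>
  The property that gives monolithic groups their name: the center is the least nontrivial normal
  subgroup.
\<close>

lemma center_le_normal:
  assumes "N \<lhd> G" "N \<noteq> {\<one>}"
  shows "group_center G \<subseteq> N"
proof
  interpret N: normal N G by fact
  obtain a where a: "a \<in> N" "a \<in> group_center G" "a \<noteq> \<one>"
    using normal_meets_center[OF assms] .
  fix b assume "b \<in> group_center G"
  then obtain k :: nat where "b = a [^] k" using center_is_powers[OF a(2,3)] by blast
  then show "b \<in> N"
    using subgroup_int_pow_closed[OF N.subgroup_axioms a(1), of "int k"] by (simp add: int_pow_int)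
qed

text \<open>
  The centralizer is the kernel of the nontrivial homomorphism \<open>x \<mapsto> [u, x]\<close> into the center,
  which has prime order. In terms of elements: if \<open>x\<close> does not commute with \<open>u\<close>, then \<open>[u, x]\<close>
  generates the center, so any \<open>y\<close> agrees with some \<open>x\<^sup>k\<close> up to an element of the centralizer.
\<close>

lemma centralizer_maximal:
  assumes u: "u \<in> second_center G" "u \<notin> group_center G"
  shows "maximal_subgroup (centralizer G u) G"
  unfolding maximal_subgroup_def
proof (intro conjI allI impI)
  have uc: "u \<in> carrier G" and c: "\<And>x. x \<in> carrier G \<Longrightarrow> group_commutator G u x \<in> group_center G"
    using u(1) by (auto simp: second_center_def)
  show "subgroup (centralizer G u) G" by (rule centralizer_subgroup[OF uc])
  show "centralizer G u \<noteq> carrier G" using centralizer_eq_carrier_iff[OF uc] u(2) by simp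
  fix H assume H: "subgroup H G" "centralizer G u \<subseteq> H"
  interpret H: subgroup H G by (rule H(1))
  show "H = centralizer G u \<or> H = carrier G"
  proof (rule disjCI)
    assume "H \<noteq> carrier G"
    then obtain y where y: "y \<in> carrier G" "y \<notin> H" using H.subset by blast
    have "x \<in> centralizer G u" if x: "x \<in> H" for x
    proof (rule ccontr)
      assume "x \<notin> centralizer G u"
      have xc: "x \<in> carrier G" using x by (rule H.mem_carrier)
      have "group_commutator G u x \<noteq> \<one>"
        using \<open>x \<notin> centralizer G u\<close> commutator_eq_one_iff[OF uc xc] by simp
      then obtain k :: nat where k: "group_commutator G u y = group_commutator G u x [^] k"
        using center_is_powers[OF c[OF xc] _ c[OF y(1)]] by blast
      let ?w = "y \<otimes> inv (x [^] k)"
      have "y = ?w \<otimes> x [^] k" using y xc by (simp add: m_assoc)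
      then have "group_commutator G u y = group_commutator G u ?w \<otimes> group_commutator G u (x [^] k)"
        using commutator_mult_right[OF uc _ _ c, of ?w "x [^] k"] y xc by simp
      then have "group_commutator G u ?w = \<one>"
        using k commutator_pow_right[OF uc xc c[OF xc], of k] uc xc y by simp
      then have "?w \<in> H" using commutator_eq_one_iff[OF uc, of ?w] y xc H(2) by auto
      moreover have "x [^] k \<in> H"
        using subgroup_int_pow_closed[OF H(1) x, of "int k"] by (simp add: int_pow_int)
      ultimately have "y \<in> H" using \<open>y = ?w \<otimes> x [^] k\<close> by (metis H.m_closed)
      with y(2) show False ..
    qed
    then show "H = centralizer G u" using H(2) by blast
  qed
qed

text \<open>
  The correction term is a power of a central commutator, whose order divides \<open>p\<close>. The exponent
  \<open>p choose 2\<close> is a multiple of \<open>p\<close> exactly because \<open>p\<close> is odd.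
\<close>

lemma pow_p_mult:
  assumes "p > 2" and x: "x \<in> carrier G" and y: "y \<in> carrier G"
    and c: "group_commutator G y x \<in> group_center G"
  shows "(x \<otimes> y) [^] p = x [^] p \<otimes> y [^] p"
proof -
  let ?c = "group_commutator G y x"
  have "p dvd p choose 2" using \<open>p > 2\<close> prime_p by (intro dvd_choose_prime) auto
  then obtain k where k: "p choose 2 = p * k" by blast
  have "?c [^] (p * k) = (?c [^] p) [^] k" using x y by (simp add: nat_pow_pow)
  also have "\<dots> = \<one>" by (simp add: center_pow_p[OF c])
  finally show ?thesis
    using pow_mult_central_commutator[OF x y c, of p] x y k by simp
qed

text \<open>
  Since \<open>h\<close> commutes with \<open>M\<close>, its commutator with \<open>m g\<^sup>i\<close> is \<open>[h, g]\<^sup>i\<close>.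
\<close>

lemma center_of_maximal_le_second_center:
  assumes M: "maximal_subgroup M G" and g: "g \<in> carrier G" "g \<notin> M"
    and h: "h \<in> group_center (G\<lparr>carrier := M\<rparr>)" and c: "group_commutator G h g \<in> group_center G"
  shows "h \<in> second_center G"
proof -
  interpret M: subgroup M G using M by (simp add: maximal_subgroup_def)
  have hM: "h \<in> M" and comm: "\<And>m. m \<in> M \<Longrightarrow> h \<otimes> m = m \<otimes> h" using h by auto
  have hc: "h \<in> carrier G" using hM by (rule M.mem_carrier)
  have "group_commutator G h x \<in> group_center G" if x: "x \<in> carrier G" for x
  proof -
    obtain m and i :: nat where m: "m \<in> M" and xm: "x = m \<otimes> g [^] i"
      using maximal_subgroup_decomposition[OF M g x] .
    have mc: "m \<in> carrier G" using m by (rule M.mem_carrier)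
    have hm: "group_commutator G h m = \<one>" using comm[OF m] hc mc by (simp add: commutator_eq_iff)
    have "group_commutator G h x = \<one> \<otimes> group_commutator G h g [^] i"
      using commutator_mult_right[OF hc mc, of "g [^] i"] commutator_pow_right[OF hc g(1) c, of i] g
        subgroup.one_closed[OF center_subgroup] by (simp add: hm xm)
    also have "\<dots> \<in> group_center G"
      using subgroup_int_pow_closed[OF center_subgroup c, of "int i"] hc g by (simp add: int_pow_int)
    finally show ?thesis .
  qed
  then show ?thesis using hc by (simp add: second_center_def)
qed

lemma second_center_pow_p:
  assumes u: "u \<in> second_center G" shows "u [^] p \<in> group_center G"
proof -
  have uc: "u \<in> carrier G" and c: "\<And>x. x \<in> carrier G \<Longrightarrow> group_commutator G u x \<in> group_center G"
    using u by (auto simp: second_center_def)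
  have "x \<in> centralizer G (u [^] p)" if x: "x \<in> carrier G" for x
    using commutator_pow_left[OF uc x c[OF x], of p] center_pow_p[OF c[OF x]]
      commutator_eq_one_iff[of "u [^] p" x] uc x by simp
  then have "centralizer G (u [^] p) = carrier G"
    using subgroup.subset[OF centralizer_subgroup] uc by blast
  then show ?thesis using centralizer_eq_carrier_iff[of "u [^] p"] uc by simp
qed

text \<open>
  If \<open>h\<^sup>p \<noteq> 1\<close>, this power generates the center, so some \<open>h\<^bsup>pi\<^esup>\<close> cancels \<open>k\<^sup>p\<close> and \<open>u = k h\<^sup>i\<close> will do. An
  element of \<open>M\<close> outside \<open>N\<close> commutes with \<open>h\<close> but not with \<open>k\<close>, whence \<open>u\<close> is not central.
\<close>

lemma ex_order_p_in_second_center: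
  assumes "p > 2" and M: "maximal_subgroup M G" and N: "maximal_subgroup N G" and "M \<noteq> N"
    and h: "h \<in> group_center (G\<lparr>carrier := M\<rparr>)" "h \<in> second_center G" "h \<notin> group_center G"
    and k: "k \<in> group_center (G\<lparr>carrier := N\<rparr>)" "k \<in> second_center G" "k \<notin> group_center G"
  obtains u where "u \<in> second_center G" "u \<notin> group_center G" "u [^] p = \<one>"
proof (cases "h [^] p = \<one>")
  case True
  with h that show thesis by blast
next
  case False
  have hc: "h \<in> carrier G" and kc: "k \<in> carrier G"
    using h(2) k(2) by (auto simp: second_center_def)
  have Nsub: "N \<subseteq> carrier G" using N subgroup.subset by (auto simp: maximal_subgroup_def)
  have Msub: "M \<subseteq> carrier G" using M subgroup.subset by (auto simp: maximal_subgroup_def)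
  have "inv (k [^] p) \<in> group_center G"
    using subgroup.m_inv_closed[OF center_subgroup second_center_pow_p[OF k(2)]] .
  then obtain i :: nat where i: "inv (k [^] p) = (h [^] p) [^] i"
    using center_is_powers[OF second_center_pow_p[OF h(2)] False] by blast
  let ?u = "k \<otimes> h [^] i"
  have hi: "h [^] i \<in> second_center G" using h(2) by (rule second_center_pow_closed)
  have "?u [^] p = k [^] p \<otimes> (h [^] i) [^] p"
    using hi kc hc by (intro pow_p_mult[OF \<open>p > 2\<close>]) (auto simp: second_center_def)
  also have "(h [^] i) [^] p = inv (k [^] p)" using i hc by (simp add: nat_pow_pow mult.commute)
  finally have "?u [^] p = \<one>" using kc by simp
  moreover have "?u \<in> second_center G" by (rule second_center_closed[OF k(2) hi])
  moreover have "?u \<notin> group_center G"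
  proof
    assume u: "?u \<in> group_center G"
    obtain m where m: "m \<in> M" "m \<notin> N"
      using M N \<open>M \<noteq> N\<close> unfolding maximal_subgroup_def by blast
    have mc: "m \<in> carrier G" using m Msub by blast
    have "m \<in> centralizer G h" using h(1) m(1) mc by (simp add: centralizer_def)
    then have "m \<otimes> h [^] i = h [^] i \<otimes> m"
      using hc mc group_commutes_pow[of h m i] by (simp add: centralizer_def)
    then have "k \<otimes> m \<otimes> h [^] i = m \<otimes> k \<otimes> h [^] i"
      using central_commute[OF u mc] hc kc mc by (simp add: m_assoc)
    then have "k \<otimes> m = m \<otimes> k" using hc kc mc by simp
    then have "m \<in> centralizer G k" using mc by (simp add: centralizer_def)
    moreover have "N \<subseteq> centralizer G k" using k(1) Nsub by (auto simp: centralizer_def)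
    ultimately have "centralizer G k = carrier G"
      using N m(2) centralizer_subgroup[OF kc] unfolding maximal_subgroup_def by blast
    then show False using centralizer_eq_carrier_iff[OF kc] k(3) by simp
  qed
  ultimately show thesis using that by blast
qed

text \<open>
  If all automorphisms of order \<open>p\<close> that fix a maximal subgroup pointwise are inner, then the fact \<open>commutator\<close> below expresses
  every element of order \<open>p\<close> in \<open>Z(M)\<close> as a commutator \<open>[h, g]\<close> with \<open>h \<in> Z(M)\<close>. It is used twice:
  for a central element, to produce noncentral elements of \<open>Z(M)\<close>, and for a noncentral one, to
  contradict the hypothesis on commutators.
\<close>

theorem ex_noninner_automorphism_fixing_maximal_subgroup:
  assumes "p > 2" and nonab: "\<not> comm_group G"
    and hyp: "\<And>M g z. maximal_subgroup M G \<Longrightarrow> g \<in> carrier G - M \<Longrightarrow>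
           z \<in> group_center (G\<lparr>carrier := M\<rparr>) \<Longrightarrow> group_commutator G z g \<in> group_center G"
  shows "\<exists>\<alpha> M. maximal_subgroup M G \<and> \<alpha> \<in> auto G \<and> \<alpha> \<notin> inner_auto G \<and>
    group.ord (AutoGroup G) \<alpha> = p \<and> (\<forall>m \<in> M. \<alpha> m = m)"
proof (rule ccontr)
  assume "\<not> ?thesis"
  then have inner: "\<alpha> \<in> inner_auto G"
    if "maximal_subgroup M G" "\<alpha> \<in> auto G" "group.ord (AutoGroup G) \<alpha> = p" "\<And>m. m \<in> M \<Longrightarrow> \<alpha> m = m"
    for M \<alpha> using that by blast
  have commutator: "\<exists>h. h \<in> group_center (G\<lparr>carrier := M\<rparr>) \<and> group_commutator G h g = u"
    if M: "maximal_subgroup M G" and g: "g \<in> carrier G" "g \<notin> M"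
      and u: "u \<in> group_center (G\<lparr>carrier := M\<rparr>)" "u \<noteq> \<one>" "u [^] p = \<one>"
    for M g u
  proof -
    have uM: "u \<in> M" using u by simp
    have uc: "u \<in> carrier G" using uM M subgroup.mem_carrier[of M G] unfolding maximal_subgroup_def by blast
    have "group_commutator G u g \<in> group_center G" using hyp[OF M _ u(1)] g by blast
    then have "(g \<otimes> u) [^] p = g [^] p" using pow_p_mult[OF \<open>p > 2\<close> g(1) uc] u(3) g by simp
    then obtain \<alpha> where \<alpha>: "\<alpha> \<in> auto G" "\<And>m. m \<in> M \<Longrightarrow> \<alpha> m = m" "\<alpha> g = g \<otimes> u"
      using ex_automorphism_fixing_maximal_subgroup[OF M g u(1)] by blast
    have "group.ord (AutoGroup G) \<alpha> = p"
      using ord_automorphism_fixing_maximal_subgroup[OF M g \<alpha> uM u(2,3)] .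
    then have "\<alpha> \<in> inner_auto G" using inner[OF M \<alpha>(1)] \<alpha>(2) by blast
    then show ?thesis
      using inner_fixing_maximal_subgroup[OF M g _ \<alpha>(2,3) uM u(2)] by blast
  qed
  have outside: "\<exists>g. g \<in> carrier G \<and> g \<notin> M" if "maximal_subgroup M G" for M
    using that subgroup.subset by (auto simp: maximal_subgroup_def)
  have "\<not> group_center G \<subseteq> {\<one>}"
    using card_center p_gt_1 card_mono[of "{\<one>}" "group_center G"] by auto
  then obtain z where z: "z \<in> group_center G" "z \<noteq> \<one>" by blast
  \<comment> \<open>Here \<open>commutator\<close> is applied to the central element \<open>z\<close>, which lies in every maximal subgroup.\<close>
  have noncentral: "\<exists>h. h \<in> group_center (G\<lparr>carrier := M\<rparr>) \<and> h \<in> second_center G \<and> h \<notin> group_center G"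
    if M: "maximal_subgroup M G" for M
  proof -
    have Mc: "M \<subseteq> carrier G" using M subgroup.subset by (auto simp: maximal_subgroup_def)
    obtain g where g: "g \<in> carrier G" "g \<notin> M" using outside[OF M] by blast
    have "z \<in> M"
      using center_le_normal[OF maximal_subgroup_normal[OF M] maximal_subgroup_nontrivial[OF nonab M]] z by blast
    then have "z \<in> group_center (G\<lparr>carrier := M\<rparr>)" using central_commute[OF z(1)] Mc by auto
    then obtain h where h: "h \<in> group_center (G\<lparr>carrier := M\<rparr>)" "group_commutator G h g = z"
      using commutator[OF M g _ z(2) center_pow_p[OF z(1)]] by blast
    have hc: "h \<in> carrier G" using h(1) Mc by auto
    have "h \<in> second_center G"
      using center_of_maximal_le_second_center[OF M g h(1)] h(2) z(1) by simp
    moreover have "h \<notin> group_center G"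
      using h(2) z(2) commutator_eq_one_iff[OF hc g(1)] centralizer_eq_carrier_iff[OF hc] g(1) by blast
    ultimately show ?thesis using h(1) by blast
  qed
  obtain M N where MN: "maximal_subgroup M G" "maximal_subgroup N G" "M \<noteq> N"
    using ex_two_maximal_subgroups[OF nonab] .
  obtain u where u: "u \<in> second_center G" "u \<notin> group_center G" "u [^] p = \<one>"
    using noncentral[OF MN(1)] noncentral[OF MN(2)] ex_order_p_in_second_center[OF \<open>p > 2\<close> MN]
    by (elim exE conjE) blast
  \<comment> \<open>Now \<open>commutator\<close> is applied to the noncentral element \<open>u\<close> and the maximal subgroup it commutes with.\<close>
  let ?C = "centralizer G u"
  have uc: "u \<in> carrier G" using u(1) by (simp add: second_center_def)
  have C: "maximal_subgroup ?C G" by (rule centralizer_maximal[OF u(1,2)])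
  have uC: "u \<in> group_center (G\<lparr>carrier := ?C\<rparr>)" using uc by (auto simp: centralizer_def)
  obtain g where g: "g \<in> carrier G" "g \<notin> ?C" using outside[OF C] by blast
  have "u \<noteq> \<one>" using u(2) subgroup.one_closed[OF center_subgroup] by blast
  then obtain h where h: "h \<in> group_center (G\<lparr>carrier := ?C\<rparr>)" "group_commutator G h g = u"
    using commutator[OF C g uC _ u(3)] by blast
  have "group_commutator G h g \<in> group_center G" using hyp[OF C _ h(1)] g by blast
  then show False using h(2) u(2) by simp
qed

end

theorem theorem2p3:
  fixes G :: "('a, 'b) monoid_scheme" and p :: nat
  assumes "Factorial_Ring.prime p" and "p > 2"
    and "finite_p_group p G"
    and "\<not> comm_group G"
    and "monolithic p G"
    and "\<And>M. maximal_subgroup M G \<Longrightarrow> \<not> comm_group (G\<lparr>carrier := M\<rparr>)"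
    and "\<And>M g z. maximal_subgroup M G \<Longrightarrow> g \<in> carrier G - M \<Longrightarrow>
           z \<in> group_center (G\<lparr>carrier := M\<rparr>) \<Longrightarrow> group_commutator G z g \<in> group_center G"
  shows "\<exists>\<alpha>. \<alpha> \<in> auto G \<and> \<alpha> \<notin> inner_auto G \<and> group.ord (AutoGroup G) \<alpha> = p \<and>
           (\<forall>x \<in> frattini G. \<alpha> x = x)"
proof -
  have "group G" using assms(3) by (simp add: finite_p_group_def)
  then interpret monolithic_p_group G p
    using assms(1,3,5) monolithic_iff_card_center[of G p]
    unfolding monolithic_p_group_def p_group_def p_group_axioms_def
      monolithic_p_group_axioms_def finite_p_group_def by blast
  have "\<exists>\<alpha> M. maximal_subgroup M G \<and> \<alpha> \<in> auto G \<and> \<alpha> \<notin> inner_auto G \<and>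
    group.ord (AutoGroup G) \<alpha> = p \<and> (\<forall>m \<in> M. \<alpha> m = m)"
    by (rule ex_noninner_automorphism_fixing_maximal_subgroup[OF assms(2,4)]) (rule assms(7))
  then show ?thesis unfolding frattini_def by blast
qed

end
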